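(* Let $\ell>0$ and $T>0$. Let $A(t)=\sum_{i=1}^{N(t)}\xi_i$ be the process of attempted purchases, let $B_\ell(T)$ be the outstanding balance at time $T$ under the policy which bars all further purchases after the first declined purchase, and let $\bar B_\ell(T)$ be the outstanding balance at time $T$ under the policy which allows further purchase attempts after a declined purchase. Then $$\mathbf{E}[B_\ell(T)]\;\le\;\mathbf{E}[\bar B_\ell(T)]\;\le\;\mathbf{E}[\min(A(T),\ell)].$$
   Context: The attempted purchases follow a marked point process $A(t)=\sum_{i=1}^{N(t)}\xi_i$, where $(\xi_i)_{i\ge1}$ are non-negative independent random variables with common distribution function $F$, and $N(t)$, independent of $(\xi_i)_{i\ge1}$, is the number of events in $(0,t]$ of a renewal process with inter-event time distribution $G$; $F$ and $G$ are of exponential order with all moments finite, and their Laplace transforms have strictly negative abscissae of convergence. Both balances start at $0$ and are driven by the same attempted purchases under credit limit $\ell$. Balance $B_\ell$: if an attempted purchase would cause the outstanding balance to exceed $\ell$, it is rejected and no further purchases are allowed, so $B_\ell(t)=\sup_{0\le u\le t}\{A(u):A(u)\le\ell\}$. Balance $\bar B_\ell$: an attempted purchase of size $\xi_i$ is accepted (and added to the balance) if the current balance plus $\xi_i$ does not exceed $\ell$; otherwise it is rejected, the balance is unchanged, and subsequent attempts are still permitted under the same rule. *)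

theory Defs
  imports "HOL-Probability.Probability"
begin

text \<open>Sequences of random variables are indexed from 1; the value at index 0 is never used.\<close>

text \<open>\<open>renewal_count \<tau> t \<omega>\<close> is the number of renewal epochs in \<open>(0,t]\<close>. On a path with infinitely many
  epochs in \<open>(0,t]\<close> (a null event for independent, identically distributed \<open>\<tau> i \<ge> 0\<close>) it is 0,
  by the convention for \<open>card\<close>.\<close>

definition renewal_epoch :: "(nat \<Rightarrow> 'a \<Rightarrow> real) \<Rightarrow> nat \<Rightarrow> 'a \<Rightarrow> real" where
  "renewal_epoch \<tau> n \<omega> = (\<Sum>i=1..n. \<tau> i \<omega>)"

definition renewal_count :: "(nat \<Rightarrow> 'a \<Rightarrow> real) \<Rightarrow> real \<Rightarrow> 'a \<Rightarrow> nat" where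
  "renewal_count \<tau> t \<omega> = card {n. 1 \<le> n \<and> renewal_epoch \<tau> n \<omega> \<in> {0<..t}}"

definition attempted :: "(nat \<Rightarrow> 'a \<Rightarrow> real) \<Rightarrow> (nat \<Rightarrow> 'a \<Rightarrow> real) \<Rightarrow> real \<Rightarrow> 'a \<Rightarrow> real" where
  "attempted \<xi> \<tau> t \<omega> = (\<Sum>i=1..renewal_count \<tau> t \<omega>. \<xi> i \<omega>)"

definition balance_barred ::
    "(nat \<Rightarrow> 'a \<Rightarrow> real) \<Rightarrow> (nat \<Rightarrow> 'a \<Rightarrow> real) \<Rightarrow> real \<Rightarrow> real \<Rightarrow> 'a \<Rightarrow> real" where
  "balance_barred \<xi> \<tau> l t \<omega> =
     Sup {attempted \<xi> \<tau> u \<omega> | u. 0 \<le> u \<and> u \<le> t \<and> attempted \<xi> \<tau> u \<omega> \<le> l}"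

text \<open>\<open>balance_after l x n\<close> is the balance after the first \<open>n\<close> attempts, of sizes \<open>x 1, \<dots>, x n\<close>,
  when attempts are still permitted after a rejection.\<close>

primrec balance_after :: "real \<Rightarrow> (nat \<Rightarrow> real) \<Rightarrow> nat \<Rightarrow> real" where
  "balance_after l x 0 = 0"
| "balance_after l x (Suc n) =
     (if balance_after l x n + x (Suc n) \<le> l then balance_after l x n + x (Suc n)
      else balance_after l x n)"

definition balance_retry ::
    "(nat \<Rightarrow> 'a \<Rightarrow> real) \<Rightarrow> (nat \<Rightarrow> 'a \<Rightarrow> real) \<Rightarrow> real \<Rightarrow> real \<Rightarrow> 'a \<Rightarrow> real" where
  "balance_retry \<xi> \<tau> l t \<omega> = balance_after l (\<lambda>i. \<xi> i \<omega>) (renewal_count \<tau> t \<omega>)"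

definition exponential_order :: "(real \<Rightarrow> real) \<Rightarrow> bool" where
  "exponential_order F \<longleftrightarrow> (\<exists>a. F \<in> O[at_top](\<lambda>x. exp (a * x)))"

text \<open>In the following two definitions \<open>F\<close> is a distribution function, and \<open>interval_measure F\<close> its
  Lebesgue-Stieltjes measure. The transform is \<open>s \<mapsto> \<integral> exp (- s x) dF(x)\<close>; its integrand is positive
  for real \<open>s\<close>, so convergence is integrability.\<close>

definition all_moments_finite :: "(real \<Rightarrow> real) \<Rightarrow> bool" where
  "all_moments_finite F \<longleftrightarrow> (\<forall>k::nat. integrable (interval_measure F) (\<lambda>x. x ^ k))"

definition laplace_abscissa :: "(real \<Rightarrow> real) \<Rightarrow> ereal" where
  "laplace_abscissa F = Inf {ereal s | s. integrable (interval_measure F) (\<lambda>x. exp (- s * x))}"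

end

theory Submission
  imports Defs
begin

text \<open>Both inequalities hold path by path off the null set where infinitely many epochs fall in
  \<open>(0,T]\<close>: a partial sum of the attempts that is at most \<open>l\<close> has been accepted entirely by the retrying
  policy, whose balance never decreases, stays at most \<open>l\<close>, and never exceeds the sum of all attempts.
  The exceptional set is null because \<open>E[exp (- S\<^sub>n)] = c ^ n\<close> with \<open>c = E[exp (- \<tau>\<^sub>1)]\<close>, which tends to 0
  unless \<open>c = 1\<close>; and in that case all epochs are at 0, so none is counted.\<close>

lemma balance_after_nonneg:
  assumes "\<And>i. 1 \<le> i \<Longrightarrow> 0 \<le> x i"
  shows "0 \<le> balance_after l x n"
  using assms by (induction n) auto

lemma balance_after_le_limit:
  assumes "0 \<le> l"
  shows "balance_after l x n \<le> l"
  using assms by (induction n) auto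

lemma balance_after_le_sum:
  assumes "\<And>i. 1 \<le> i \<Longrightarrow> 0 \<le> x i"
  shows "balance_after l x n \<le> (\<Sum>i=1..n. x i)"
proof (induction n)
  case (Suc n)
  have "0 \<le> x (Suc n)" using assms by simp
  with Suc show ?case by simp
qed simp

lemma balance_after_mono:
  assumes "\<And>i. 1 \<le> i \<Longrightarrow> 0 \<le> x i" and "m \<le> n"
  shows "balance_after l x m \<le> balance_after l x n"
proof -
  have "balance_after l x k \<le> balance_after l x (Suc k)" for k
    using assms(1)[of "Suc k"] by simp
  then show ?thesis using \<open>m \<le> n\<close> by (rule lift_Suc_mono_le)
qed

text \<open>The sizes are non-negative, so a bound \<open>l\<close> on the sum of the first
  \<open>m\<close> attempts also bounds every shorter partial sum, and no attempt up to
  \<open>m\<close> is rejected.\<close>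

lemma balance_after_eq_sum:
  assumes "\<And>i. 1 \<le> i \<Longrightarrow> 0 \<le> x i" and "(\<Sum>i=1..m. x i) \<le> l"
  shows "balance_after l x m = (\<Sum>i=1..m. x i)"
  using assms(2)
proof (induction m)
  case (Suc m)
  have "0 \<le> x (Suc m)" using assms(1) by simp
  with Suc show ?case by simp
qed simp

lemma renewal_epoch_mono:
  assumes "\<And>i. 1 \<le> i \<Longrightarrow> 0 \<le> \<tau> i \<omega>" and "m \<le> n"
  shows "renewal_epoch \<tau> m \<omega> \<le> renewal_epoch \<tau> n \<omega>"
  unfolding renewal_epoch_def using assms by (intro sum_mono2) auto

text \<open>An infinite set of indices is unbounded, so some counted index lies at or beyond
  \<open>m\<close>; its epoch is at most \<open>t\<close> and dominates epoch
  \<open>m\<close>.\<close>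

lemma renewal_epoch_le_of_infinite:
  assumes "\<And>i. 1 \<le> i \<Longrightarrow> 0 \<le> \<tau> i \<omega>"
    and "infinite {n. 1 \<le> n \<and> renewal_epoch \<tau> n \<omega> \<in> {0<..t}}"
  shows "renewal_epoch \<tau> m \<omega> \<le> t"
proof -
  obtain n where "m \<le> n" "renewal_epoch \<tau> n \<omega> \<in> {0<..t}"
    using assms(2) unfolding infinite_nat_iff_unbounded_le by blast
  then show ?thesis
    using renewal_epoch_mono[of \<tau> \<omega> m n] assms(1) by fastforce
qed

text \<open>Finiteness excludes the convention that \<open>card\<close> is 0 on infinite sets, under
  which the count at \<open>t\<close> could drop to 0 while the count at \<open>u\<close> is
  positive.\<close>

lemma renewal_count_mono:
  assumes "finite {n. 1 \<le> n \<and> renewal_epoch \<tau> n \<omega> \<in> {0<..t}}" and "u \<le> t"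
  shows "renewal_count \<tau> u \<omega> \<le> renewal_count \<tau> t \<omega>"
  unfolding renewal_count_def using assms by (intro card_mono) auto

lemma balance_barred_le_retry:
  assumes x: "\<And>i. 1 \<le> i \<Longrightarrow> 0 \<le> \<xi> i \<omega>" and "0 \<le> l" "0 \<le> t"
    and fin: "finite {n. 1 \<le> n \<and> renewal_epoch \<tau> n \<omega> \<in> {0<..t}}"
  shows "balance_barred \<xi> \<tau> l t \<omega> \<le> balance_retry \<xi> \<tau> l t \<omega>"
  unfolding balance_barred_def
proof (rule cSup_least)
  \<comment> \<open>The supremum needs a non-empty set; time 0 supplies the member 0, because the
    interval \<open>{0<..0}\<close> is empty.\<close>
  have "renewal_count \<tau> 0 \<omega> = 0" by (simp add: renewal_count_def)
  then have "attempted \<xi> \<tau> 0 \<omega> \<le> l" using \<open>0 \<le> l\<close> by (simp add: attempted_def)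
  with \<open>0 \<le> t\<close> show "{attempted \<xi> \<tau> u \<omega> | u. 0 \<le> u \<and> u \<le> t \<and> attempted \<xi> \<tau> u \<omega> \<le> l} \<noteq> {}"
    by blast
next
  fix y assume "y \<in> {attempted \<xi> \<tau> u \<omega> | u. 0 \<le> u \<and> u \<le> t \<and> attempted \<xi> \<tau> u \<omega> \<le> l}"
  then obtain u where u: "y = attempted \<xi> \<tau> u \<omega>" "u \<le> t" "attempted \<xi> \<tau> u \<omega> \<le> l" by blast
  then have "y = balance_after l (\<lambda>i. \<xi> i \<omega>) (renewal_count \<tau> u \<omega>)"
    using balance_after_eq_sum[of "\<lambda>i. \<xi> i \<omega>"] x by (simp add: attempted_def)
  also have "\<dots> \<le> balance_after l (\<lambda>i. \<xi> i \<omega>) (renewal_count \<tau> t \<omega>)"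
    using x renewal_count_mono[OF fin u(2)] by (intro balance_after_mono) auto
  finally show "y \<le> balance_retry \<xi> \<tau> l t \<omega>" by (simp add: balance_retry_def)
qed

lemma measurable_renewal_count:
  assumes [measurable]: "\<And>i. 1 \<le> i \<Longrightarrow> \<tau> i \<in> borel_measurable M"
  shows "renewal_count \<tau> t \<in> measurable M (count_space UNIV)"
proof -
  have [measurable]: "renewal_epoch \<tau> n \<in> borel_measurable M" for n
    unfolding renewal_epoch_def by measurable
  show ?thesis unfolding renewal_count_def by measurable
qed

lemma measurable_balance_after:
  assumes "\<And>i. 1 \<le> i \<Longrightarrow> \<xi> i \<in> borel_measurable M"
  shows "(\<lambda>\<omega>. balance_after l (\<lambda>i. \<xi> i \<omega>) n) \<in> borel_measurable M"
proof (induction n)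
  case (Suc n)
  have [measurable]: "\<xi> (Suc n) \<in> borel_measurable M" using assms by simp
  note Suc[measurable]
  show ?case by simp
qed simp

text \<open>Ensures that \<open>renewal_count\<close> is almost surely a true count, so that the
  pathwise comparison of the two balances carries over to expectations.\<close>

lemma (in prob_space) AE_finite_renewal_epochs:
  assumes indep: "indep_vars (\<lambda>_. borel) \<tau> {1..}"
    and cdf: "\<And>i. 1 \<le> i \<Longrightarrow> cdf (distr M borel (\<tau> i)) = G"
    and nonneg: "\<And>i \<omega>. 1 \<le> i \<Longrightarrow> \<omega> \<in> space M \<Longrightarrow> 0 \<le> \<tau> i \<omega>"
  shows "AE \<omega> in M. finite {n. 1 \<le> n \<and> renewal_epoch \<tau> n \<omega> \<in> {0<..t}}"
proof -
  have rv: "\<tau> i \<in> borel_measurable M" if "1 \<le> i" for i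
    using indep that unfolding indep_vars_def by auto
  have [measurable]: "renewal_epoch \<tau> n \<in> borel_measurable M" for n
    unfolding renewal_epoch_def using rv by (intro borel_measurable_sum) auto
  have int: "integrable M (\<lambda>\<omega>. exp (- \<tau> i \<omega>))" if "1 \<le> i" for i
  proof (rule integrable_const_bound[where B=1])
    show "AE \<omega> in M. norm (exp (- \<tau> i \<omega>)) \<le> 1" using nonneg[OF that] by (intro AE_I2) simp
    show "(\<lambda>\<omega>. exp (- \<tau> i \<omega>)) \<in> borel_measurable M" using rv[OF that] by measurable
  qed
  \<comment> \<open>The Laplace transform of the inter-event law at 1; any other positive argument
    would serve as well.\<close>
  define c where "c = expectation (\<lambda>\<omega>. exp (- \<tau> 1 \<omega>))"
  have c: "expectation (\<lambda>\<omega>. exp (- \<tau> i \<omega>)) = c" if "1 \<le> i" for i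
  proof -
    have rd: "real_distribution (distr M borel (\<tau> j))" if "1 \<le> j" for j
      using rv[OF that] by simp
    \<comment> \<open>Only the distribution functions are assumed equal, but these determine the
      laws, and hence the transforms.\<close>
    have "distr M borel (\<tau> i) = distr M borel (\<tau> 1)"
      using cdf[OF that] cdf[of 1] by (intro cdf_unique rd) (use that in auto)
    then have "(\<integral>x. exp (- x) \<partial>distr M borel (\<tau> i)) = (\<integral>x. exp (- x) \<partial>distr M borel (\<tau> 1))" by simp
    then show ?thesis using rv[OF that] rv[of 1] by (simp add: integral_distr c_def)
  qed
  have "c \<le> expectation (\<lambda>_. 1)" unfolding c_def
    using int[of 1] nonneg[of 1] by (intro integral_mono) auto
  then have "c \<le> 1" by (simp add: prob_space)
  moreover have "0 \<le> c" unfolding c_def by simp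
  ultimately consider "c = 1" | "0 \<le> c" "c < 1" by linarith
  then show ?thesis
  proof cases
    case 1
    \<comment> \<open>When \<open>c = 1\<close>, the non-negative variable
      \<open>1 - exp (- \<tau> i \<omega>)\<close> has mean 0 and so vanishes almost surely.\<close>
    have "AE \<omega> in M. \<tau> i \<omega> = 0" if "1 \<le> i" for i
    proof -
      have "(\<integral>\<omega>. 1 - exp (- \<tau> i \<omega>) \<partial>M) = 0"
        using int[OF that] c[OF that] 1 by (simp add: prob_space)
      then have "AE \<omega> in M. 1 - exp (- \<tau> i \<omega>) = 0"
        using int[OF that] nonneg[OF that] by (subst (asm) integral_nonneg_eq_0_iff_AE) auto
      then show ?thesis by simp
    qed
    \<comment> \<open>Countably many null sets are merged. Outside their union every epoch is 0,
      which \<open>{0<..t}\<close> excludes, so the set of counted indices is empty.\<close>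
    then have "AE \<omega> in M. \<forall>i\<in>{1..}. \<tau> i \<omega> = 0" by (subst AE_ball_countable) auto
    then show ?thesis by eventually_elim (simp add: renewal_epoch_def)
  next
    case 2
    \<comment> \<open>This event is measurable and contains every outcome with infinitely many
      epochs in \<open>{0<..t}\<close>, so it suffices to show that it is null.\<close>
    define B where "B = {\<omega> \<in> space M. \<forall>n. renewal_epoch \<tau> n \<omega> \<le> t}"
    have [measurable]: "B \<in> events" unfolding B_def by measurable
    \<comment> \<open>A Chernoff-type bound: \<open>exp (- t)\<close> is at most
      \<open>exp (- renewal_epoch \<tau> n \<omega>)\<close> on \<open>B\<close>, and independence
      factors the expectation of the latter into \<open>c ^ n\<close>.\<close>
    have le: "exp (- t) * prob B \<le> c ^ n" for n
    proof -
      have ind: "indep_vars (\<lambda>_. borel) (\<lambda>i \<omega>. exp (- \<tau> i \<omega>)) {1..n}"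
        by (rule indep_vars_compose2[OF indep_vars_subset[OF indep]]) auto
      have prod: "exp (- renewal_epoch \<tau> n \<omega>) = (\<Prod>i=1..n. exp (- \<tau> i \<omega>))" for \<omega>
        unfolding renewal_epoch_def by (simp add: exp_sum sum_negf[symmetric])
      have "exp (- t) * prob B = expectation (\<lambda>\<omega>. exp (- t) * indicator B \<omega>)" by simp
      also have "\<dots> \<le> expectation (\<lambda>\<omega>. exp (- renewal_epoch \<tau> n \<omega>))"
      proof (rule integral_mono)
        show "integrable M (\<lambda>\<omega>. exp (- renewal_epoch \<tau> n \<omega>))"
          unfolding prod using ind int by (intro indep_vars_integrable) auto
        show "exp (- t) * indicator B \<omega> \<le> exp (- renewal_epoch \<tau> n \<omega>)" for \<omega>
          by (auto simp: B_def indicator_def)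
      qed (auto intro: integrable_real_indicator simp: emeasure_eq_measure)
      also have "\<dots> = (\<Prod>i=1..n. expectation (\<lambda>\<omega>. exp (- \<tau> i \<omega>)))"
        unfolding prod using ind int by (intro indep_vars_lebesgue_integral) auto
      also have "\<dots> = c ^ n" by (simp add: c)
      finally show ?thesis .
    qed
    have "exp (- t) * prob B \<le> 0"
      using LIMSEQ_power_zero[of c] 2 le by (intro LIMSEQ_le_const) auto
    then have "prob B = 0" by (simp add: mult_le_0_iff measure_le_0_iff)
    then have "AE \<omega> in M. \<omega> \<notin> B" by (subst (asm) prob_eq_0) auto
    then show ?thesis using AE_space
    proof eventually_elim
      case (elim \<omega>)
      then obtain m where "\<not> renewal_epoch \<tau> m \<omega> \<le> t" by (auto simp: B_def)
      moreover have "0 \<le> \<tau> i \<omega>" if "1 \<le> i" for i using nonneg[OF that elim(2)] .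
      ultimately show ?case using renewal_epoch_le_of_infinite[of \<tau> \<omega> t m] by blast
    qed
  qed
qed

theorem mainTheorem3:
  fixes M :: "'a measure"
    and \<xi> \<tau> :: "nat \<Rightarrow> 'a \<Rightarrow> real"
    and F G :: "real \<Rightarrow> real"
    and l T :: real
  assumes "prob_space M"
    and "prob_space.indep_vars M (\<lambda>_. borel) \<xi> {1..}"
    and "\<And>i. 1 \<le> i \<Longrightarrow> cdf (distr M borel (\<xi> i)) = F"
    and "\<And>i \<omega>. 1 \<le> i \<Longrightarrow> \<omega> \<in> space M \<Longrightarrow> 0 \<le> \<xi> i \<omega>"
    and "prob_space.indep_vars M (\<lambda>_. borel) \<tau> {1..}"
    and "\<And>i. 1 \<le> i \<Longrightarrow> cdf (distr M borel (\<tau> i)) = G"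
    and "\<And>i \<omega>. 1 \<le> i \<Longrightarrow> \<omega> \<in> space M \<Longrightarrow> 0 \<le> \<tau> i \<omega>"
    and "prob_space.indep_set M
           (sets (vimage_algebra (space M) (\<lambda>\<omega>. \<lambda>i\<in>{1..}. \<xi> i \<omega>) (PiM {1..} (\<lambda>_. borel))))
           (sets (vimage_algebra (space M) (\<lambda>\<omega>. \<lambda>t\<in>{0..}. renewal_count \<tau> t \<omega>)
             (PiM {0..} (\<lambda>_. count_space UNIV))))"
    and "exponential_order F" and "exponential_order G"
    and "all_moments_finite F" and "all_moments_finite G"
    and "laplace_abscissa F < 0" and "laplace_abscissa G < 0"
    and "0 < l" and "0 < T"
  shows "prob_space.expectation M (balance_barred \<xi> \<tau> l T)
           \<le> prob_space.expectation M (balance_retry \<xi> \<tau> l T)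
       \<and> prob_space.expectation M (balance_retry \<xi> \<tau> l T)
           \<le> prob_space.expectation M (\<lambda>\<omega>. min (attempted \<xi> \<tau> T \<omega>) l)"
proof -
  interpret prob_space M by fact
  have \<xi>: "\<xi> i \<in> borel_measurable M" and \<tau>: "\<tau> i \<in> borel_measurable M" if "1 \<le> i" for i
    using assms(2,5) that unfolding indep_vars_def by auto
  have N: "renewal_count \<tau> T \<in> measurable M (count_space UNIV)"
    using \<tau> by (rule measurable_renewal_count)
  have retry_meas: "balance_retry \<xi> \<tau> l T \<in> borel_measurable M"
    unfolding balance_retry_def
  \<comment> \<open>The random number of attempts takes countably many values, so measurability
    reduces to that for each fixed number \<open>n\<close>.\<close>
  proof (rule measurable_compose_countable[OF _ N])
    show "(\<lambda>\<omega>. balance_after l (\<lambda>i. \<xi> i \<omega>) n) \<in> borel_measurable M" for n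
      using \<xi> by (rule measurable_balance_after)
  qed
  have "(\<lambda>\<omega>. \<Sum>i=1..n. \<xi> i \<omega>) \<in> borel_measurable M" for n
    using \<xi> by (intro borel_measurable_sum) auto
  then have attempted_meas: "attempted \<xi> \<tau> T \<in> borel_measurable M"
    unfolding attempted_def by (rule measurable_compose_countable[OF _ N])
  have retry_nonneg: "0 \<le> balance_retry \<xi> \<tau> l T \<omega>" if "\<omega> \<in> space M" for \<omega>
    using assms(4) that by (simp add: balance_retry_def balance_after_nonneg)
  have retry_le: "balance_retry \<xi> \<tau> l T \<omega> \<le> min (attempted \<xi> \<tau> T \<omega>) l" if "\<omega> \<in> space M" for \<omega>
    using assms(4) that \<open>0 < l\<close> balance_after_le_sum[of "\<lambda>i. \<xi> i \<omega>"]
    by (simp add: balance_retry_def attempted_def balance_after_le_limit)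
  have retry_int: "integrable M (balance_retry \<xi> \<tau> l T)"
  proof (rule integrable_const_bound[where B=l])
    show "AE \<omega> in M. norm (balance_retry \<xi> \<tau> l T \<omega>) \<le> l"
      using retry_nonneg retry_le by (intro AE_I2) simp
  qed (rule retry_meas)
  have min_int: "integrable M (\<lambda>\<omega>. min (attempted \<xi> \<tau> T \<omega>) l)"
  proof (rule integrable_const_bound[where B=l])
    show "AE \<omega> in M. norm (min (attempted \<xi> \<tau> T \<omega>) l) \<le> l"
    proof (rule AE_I2)
      fix \<omega> assume "\<omega> \<in> space M"
      \<comment> \<open>The retrying balance lies between 0 and the minimum, so the minimum is
        non-negative and its norm is at most \<open>l\<close>.\<close>
      from retry_nonneg[OF this] retry_le[OF this]
      show "norm (min (attempted \<xi> \<tau> T \<omega>) l) \<le> l" by simp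
    qed
  qed (use attempted_meas in measurable)
  have "AE \<omega> in M. finite {n. 1 \<le> n \<and> renewal_epoch \<tau> n \<omega> \<in> {0<..T}}"
    using assms(5-7) by (rule AE_finite_renewal_epochs)
  then have "AE \<omega> in M. balance_barred \<xi> \<tau> l T \<omega> \<le> balance_retry \<xi> \<tau> l T \<omega>"
    using AE_space
  proof eventually_elim
    case (elim \<omega>)
    then show ?case
      using assms(4) \<open>0 < l\<close> \<open>0 < T\<close> by (intro balance_barred_le_retry) auto
  qed
  \<comment> \<open>No measurability of the barred balance is needed: if it is not integrable, its integral is 0.\<close>
  then have "expectation (balance_barred \<xi> \<tau> l T) \<le> expectation (balance_retry \<xi> \<tau> l T)"
    using retry_int retry_nonneg by (intro integral_mono_AE') auto
  moreover have "expectation (balance_retry \<xi> \<tau> l T)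
      \<le> expectation (\<lambda>\<omega>. min (attempted \<xi> \<tau> T \<omega>) l)"
    using retry_int min_int retry_le by (rule integral_mono)
  ultimately show ?thesis ..
qed

end
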